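(* Let $G$ be a connected graph of order $n$. Then $h_p(G)\le \max\{1,\,n-mt^*(G)\}$.
   Context: Graphs are finite, undirected and loopless (multiple edges are allowed). The line graph $L(G)$ has vertex set $E(G)$, two vertices being adjacent if and only if the corresponding edges of $G$ share an endpoint; $L^0(G)=G$, $L^1(G)=L(G)$, $L^m(G)=L(L^{m-1}(G))$ (with $L^{m-1}(G)$ assumed to have a nonempty edge set). A graph is traceable if it has a hamiltonian path. The hamiltonian path index $h_p(G)$ is the minimum integer $m\ge 0$ such that $L^m(G)$ is traceable (so $h_p(G)=0$ if $G$ is traceable). $mt^*(G)$ is the maximum number of (distinct) vertices of a trail of $G$, where a trail may be open or closed, possibly trivial, and may repeat vertices but not edges. *)

theory Defs
  imports Main "HOL-Library.FSet" "HOL-Library.Extended_Nat"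
begin

record ('v, 'e) mgraph =
  verts :: "'v set"
  edges :: "'e set"
  ends :: "'e \<Rightarrow> 'v set"

text \<open>Finite loopless multigraphs: parallel edges are distinct edges with the same
  two-element set of endpoints.\<close>

definition mgraph :: "('v, 'e) mgraph \<Rightarrow> bool" where
  "mgraph G \<longleftrightarrow> finite (verts G) \<and> finite (edges G) \<and>
     (\<forall>e\<in>edges G. ends G e \<subseteq> verts G \<and> card (ends G e) = 2)"

text \<open>A walk is given by its vertex sequence and its edge sequence. The vertex sequence
  is never empty, so the shortest walks are the trivial ones \<open>[v], []\<close>.\<close>

definition walk :: "('v, 'e) mgraph \<Rightarrow> 'v list \<Rightarrow> 'e list \<Rightarrow> bool" where
  "walk G vs es \<longleftrightarrow> length vs = length es + 1 \<and> set vs \<subseteq> verts G \<and> set es \<subseteq> edges G \<and>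
     (\<forall>i<length es. ends G (es ! i) = {vs ! i, vs ! (i + 1)})"

definition trail :: "('v, 'e) mgraph \<Rightarrow> 'v list \<Rightarrow> 'e list \<Rightarrow> bool" where
  "trail G vs es \<longleftrightarrow> walk G vs es \<and> distinct es"

definition path :: "('v, 'e) mgraph \<Rightarrow> 'v list \<Rightarrow> 'e list \<Rightarrow> bool" where
  "path G vs es \<longleftrightarrow> walk G vs es \<and> distinct vs"

definition connected_mgraph :: "('v, 'e) mgraph \<Rightarrow> bool" where
  "connected_mgraph G \<longleftrightarrow> verts G \<noteq> {} \<and>
     (\<forall>u\<in>verts G. \<forall>v\<in>verts G. \<exists>vs es. walk G vs es \<and> hd vs = u \<and> last vs = v)"

definition hamiltonian_path :: "('v, 'e) mgraph \<Rightarrow> 'v list \<Rightarrow> 'e list \<Rightarrow> bool" where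
  "hamiltonian_path G vs es \<longleftrightarrow> path G vs es \<and> set vs = verts G"

definition traceable :: "('v, 'e) mgraph \<Rightarrow> bool" where
  "traceable G \<longleftrightarrow> (\<exists>vs es. hamiltonian_path G vs es)"

text \<open>The maximum is over a nonempty finite set whenever \<open>G\<close> is finite and has a vertex.\<close>

definition mt_star :: "('v, 'e) mgraph \<Rightarrow> nat" where
  "mt_star G = Max {card (set vs) | vs es. trail G vs es}"

text \<open>The vertices of the line graph are the edges of the graph, so iterating the
  construction needs one type that holds the vertices and the edges of all iterates.
  \<open>Link {|x, y|}\<close> is the edge joining \<open>x\<close> and \<open>y\<close> in a line graph.\<close>

datatype ('v, 'e) elem = Vert 'v | Edge 'e | Link "('v, 'e) elem fset"

type_synonym ('v, 'e) egraph = "(('v, 'e) elem, ('v, 'e) elem) mgraph"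

definition embed :: "('v, 'e) mgraph \<Rightarrow> ('v, 'e) egraph" where
  "embed G = \<lparr>verts = Vert ` verts G, edges = Edge ` edges G,
     ends = (\<lambda>x. case x of Edge e \<Rightarrow> Vert ` ends G e | _ \<Rightarrow> {})\<rparr>"

definition line_graph :: "('v, 'e) egraph \<Rightarrow> ('v, 'e) egraph" where
  "line_graph G = \<lparr>verts = edges G,
     edges = {Link {|x, y|} | x y. x \<in> edges G \<and> y \<in> edges G \<and> x \<noteq> y \<and>
                ends G x \<inter> ends G y \<noteq> {}},
     ends = (\<lambda>x. case x of Link S \<Rightarrow> fset S | _ \<Rightarrow> {})\<rparr>"

text \<open>The zeroth iterate is an isomorphic copy of \<open>G\<close>.\<close>

definition iter_line_graph :: "nat \<Rightarrow> ('v, 'e) mgraph \<Rightarrow> ('v, 'e) egraph" where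
  "iter_line_graph m G = (line_graph ^^ m) (embed G)"

text \<open>The infimum is a minimum, or \<open>\<infinity>\<close> if no iterate is traceable. Iterates beyond
  one without edges have no vertices and are never traceable, so they do not contribute.\<close>

definition hamiltonian_path_index :: "('v, 'e) mgraph \<Rightarrow> enat" where
  "hamiltonian_path_index G = Inf {enat m | m. traceable (iter_line_graph m G)}"

lemma traceable_nonempty: "traceable G \<Longrightarrow> verts G \<noteq> {}"
  by (auto simp: traceable_def hamiltonian_path_def path_def walk_def)

lemma mgraph_embed:
  assumes "mgraph G"
  shows "mgraph (embed G)"
  using assms by (auto simp: mgraph_def embed_def card_image inj_on_def)

lemma mgraph_line_graph:
  assumes "mgraph G"
  shows "mgraph (line_graph G)"
proof -
  have "edges (line_graph G) \<subseteq> (\<lambda>(x, y). Link {|x, y|}) ` (edges G \<times> edges G)"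
    by (auto simp: line_graph_def)
  moreover have "finite (edges G)"
    using assms by (simp add: mgraph_def)
  ultimately have "finite (edges (line_graph G))"
    by (meson finite_SigmaI finite_imageI finite_subset)
  then show ?thesis
    using assms by (auto simp: mgraph_def line_graph_def)
qed

lemma walk_embed_iff:
  "walk (embed G) (map Vert vs) (map Edge es) \<longleftrightarrow> walk G vs es"
proof -
  have eq: "Vert ` A = {Vert a, Vert b} \<longleftrightarrow> A = {a, b}" for A :: "'a set" and a b
    using inj_image_eq_iff[of Vert A "{a, b}"] by (simp add: inj_def)
  show ?thesis
    by (auto simp: walk_def embed_def eq nth_map)
qed

lemma traceable_embed_iff: "traceable (embed G) \<longleftrightarrow> traceable G"
proof
  assume "traceable G"
  then obtain vs es where "walk G vs es" "distinct vs" "set vs = verts G"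
    by (auto simp: traceable_def hamiltonian_path_def path_def)
  moreover have "verts (embed G) = Vert ` verts G"
    by (simp add: embed_def)
  ultimately have "hamiltonian_path (embed G) (map Vert vs) (map Edge es)"
    by (simp add: hamiltonian_path_def path_def walk_embed_iff distinct_map inj_on_def)
  then show "traceable (embed G)"
    by (auto simp: traceable_def)
next
  assume "traceable (embed G)"
  then obtain vs es where w: "walk (embed G) vs es" "distinct vs" "set vs = verts (embed G)"
    by (auto simp: traceable_def hamiltonian_path_def path_def)
  from w(3) have "vs \<in> lists (range Vert)"
    by (auto simp: embed_def)
  then obtain vs' where vs: "vs = map Vert vs'"
    by (auto simp: lists_image)
  from w(1) have "es \<in> lists (range Edge)"
    by (auto simp: embed_def walk_def)
  then obtain es' where es: "es = map Edge es'"
    by (auto simp: lists_image)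
  have "set vs' = verts G"
    using w(3) by (auto simp: vs embed_def)
  then have "hamiltonian_path G vs' es'"
    using w(1,2) by (simp add: hamiltonian_path_def path_def vs es walk_embed_iff distinct_map)
  then show "traceable G"
    by (auto simp: traceable_def)
qed

end

theory Submission
  imports Defs
begin

text \<open>
  Take a trail \<open>T\<close> of \<open>G\<close> with the maximum number of vertices and call the vertices of \<open>T\<close> and those
  of degree at least three hubs. The edges meeting \<open>T\<close> form a path of \<open>L(G)\<close>; the edges at a
  further hub \<open>w\<close> can be spliced into a trail of \<open>L(G)\<close> that contains one of them, since they form a
  clique of order at least three. Hence in \<open>L(G)\<close> the trail swallows all hubs that are adjacent to it,
  directly or through other hubs, while every chain of vertices of degree at most two off the
  trail loses a vertex. If \<open>k \<ge> 2\<close> vertices lie off \<open>T\<close>, then after \<open>k - 1\<close> line graphs the trail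
  dominates all edges, and the next line graph is traceable.
\<close>

section \<open>Incidence, adjacency of edges and walks\<close>

definition inc :: "('v, 'e) mgraph \<Rightarrow> 'v \<Rightarrow> 'e set" where
  "inc G v = {e \<in> edges G. v \<in> ends G e}"

text \<open>Adjacency in the line graph, expressed in \<open>G\<close> itself and for graphs of any
  type, before line graph edges get names. Parallel edges are adjacent.\<close>

definition eadj :: "('v, 'e) mgraph \<Rightarrow> 'e \<Rightarrow> 'e \<Rightarrow> bool" where
  "eadj G e f \<longleftrightarrow> e \<noteq> f \<and> ends G e \<inter> ends G f \<noteq> {}"

lemma eadj_sym: "eadj G e f \<longleftrightarrow> eadj G f e"
  by (auto simp: eadj_def)

lemma eadj_incI: "e \<in> inc G v \<Longrightarrow> f \<in> inc G v \<Longrightarrow> e \<noteq> f \<Longrightarrow> eadj G e f"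
  by (auto simp: eadj_def inc_def)

lemma inc_subset: "inc G v \<subseteq> edges G"
  by (auto simp: inc_def)

lemma finite_inc: "mgraph G \<Longrightarrow> finite (inc G v)"
  by (auto simp: inc_def mgraph_def)

lemma ends_obtain:
  assumes "mgraph G" "e \<in> inc G v"
  obtains x where "ends G e = {v, x}" "x \<noteq> v" "x \<in> verts G" "v \<in> verts G"
proof -
  have "card (ends G e) = 2" "v \<in> ends G e" "ends G e \<subseteq> verts G"
    using assms by (auto simp: mgraph_def inc_def)
  then obtain a b where ab: "ends G e = {a, b}" "a \<noteq> b"
    by (meson card_2_iff)
  with \<open>v \<in> ends G e\<close> \<open>ends G e \<subseteq> verts G\<close> that[of a] that[of b] show thesis
    by (auto simp: insert_commute)
qed

lemma walk_Cons_Cons: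
  "walk G (v # vs) (e # es) \<longleftrightarrow>
    v \<in> verts G \<and> e \<in> edges G \<and> vs \<noteq> [] \<and> ends G e = {v, hd vs} \<and> walk G vs es"
proof (cases vs)
  case (Cons a as)
  show ?thesis
    unfolding walk_def Cons by (auto simp: less_Suc_eq_0_disj nth_Cons' split: if_splits)
qed (auto simp: walk_def)

lemma walk_Nil: "walk G vs [] \<longleftrightarrow> (\<exists>v \<in> verts G. vs = [v])"
  by (auto simp: walk_def length_Suc_conv)

section \<open>From a trail to a path of the line graph\<close>

lemma successively_inc: "distinct xs \<Longrightarrow> set xs \<subseteq> inc G v \<Longrightarrow> successively (eadj G) xs"
  by (induction xs rule: induct_list012) (auto intro: eadj_incI)

text \<open>The set \<open>X\<close> collects the edges that are listed at an earlier vertex of the trail.\<close>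

lemma trail_edge_list_avoiding:
  assumes "mgraph G" "trail G vs es" "X \<inter> set es = {}"
  shows "\<exists>p. distinct p \<and> set p = set es \<union> (\<Union> (inc G ` set vs) - X) \<and>
    successively (eadj G) p \<and> (p \<noteq> [] \<longrightarrow> hd p \<in> inc G (hd vs))"
  using assms(2,3)
proof (induction es arbitrary: vs X)
  case Nil
  then obtain v where v: "vs = [v]" by (auto simp: trail_def walk_Nil)
  obtain p where p: "distinct p" "set p = inc G v - X"
    using finite_distinct_list finite_inc[OF assms(1)] by (metis finite_Diff)
  then have "p \<noteq> [] \<longrightarrow> hd p \<in> inc G v" using hd_in_set by fastforce
  with p show ?case by (intro exI[of _ p]) (auto simp: v intro: successively_inc)
next
  case (Cons e es)
  obtain v us where vs: "vs = v # us"
    using Cons.prems by (cases vs) (auto simp: trail_def walk_def)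
  have w: "e \<in> edges G" "us \<noteq> []" "ends G e = {v, hd us}" "walk G us es" "distinct es" "e \<notin> set es"
    using Cons.prems by (auto simp: vs trail_def walk_Cons_Cons)
  \<comment> \<open>The edges at \<open>v\<close> are listed now, except those that the trail still
    traverses: they keep their place in \<open>es\<close>, hence the subtraction of
    \<open>set es\<close>.\<close>
  let ?X = "(X \<union> inc G v \<union> {e}) - set es"
  obtain p where p: "distinct p" "set p = set es \<union> (\<Union> (inc G ` set us) - ?X)"
    "successively (eadj G) p" "p \<noteq> [] \<longrightarrow> hd p \<in> inc G (hd us)"
    using Cons.IH[of us ?X] w by (auto simp: trail_def)
  obtain l where l: "distinct l" "set l = inc G v - X - set es - {e}"
    using finite_distinct_list finite_inc[OF assms(1)] by (metis finite_Diff)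
  have ei: "e \<in> inc G v" "e \<in> inc G (hd us)" using w by (auto simp: inc_def)
  have "e \<notin> set p" using p(2) w by auto
  have "successively (eadj G) (l @ [e])"
    by (rule successively_inc[where v = v]) (use l ei in auto)
  moreover have "p \<noteq> [] \<longrightarrow> eadj G e (hd p)"
    using p(4) ei \<open>e \<notin> set p\<close> by (metis eadj_incI hd_in_set)
  ultimately have "successively (eadj G) (l @ e # p)"
    using p(3) by (auto simp: successively_append_iff successively_Cons)
  moreover have "distinct (l @ e # p)"
    using l p(1,2) \<open>e \<notin> set p\<close> by auto
  moreover have "set es \<subseteq> edges G" "X \<inter> set es = {}" "e \<notin> X"
    using Cons.prems by (auto simp: trail_def walk_def)
  then have "set (l @ e # p) = set (e # es) \<union> (\<Union> (inc G ` set vs) - X)"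
    using p(2) l(2) ei by (auto simp: vs)
  moreover have "hd (l @ e # p) \<in> inc G v"
    using l(2) ei by (cases l) auto
  ultimately show ?case by (intro exI[of _ "l @ e # p"]) (simp add: vs)
qed

lemma trail_edge_list:
  assumes "mgraph G" "trail G vs es"
  obtains p where "distinct p" "set p = \<Union> (inc G ` set vs)" "successively (eadj G) p"
proof (cases es)
  case Nil
  then show thesis using trail_edge_list_avoiding[OF assms, of "{}"] that by auto
next
  case (Cons e es')
  have "set es \<subseteq> \<Union> (inc G ` set vs)"
  proof
    fix e assume "e \<in> set es"
    then obtain i where i: "i < length es" "es ! i = e" by (auto simp: in_set_conv_nth)
    then have "vs ! i \<in> set vs" "e \<in> inc G (vs ! i)"
      using assms(2) by (auto simp: trail_def walk_def inc_def)
    then show "e \<in> \<Union> (inc G ` set vs)" by blast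
  qed
  then show thesis using trail_edge_list_avoiding[OF assms, of "{}"] that by (auto simp: Un_absorb1)
qed

section \<open>Trails of the line graph given by their vertices\<close>

text \<open>A line graph has no parallel edges, so a walk in it is determined by its vertices; these
  are the edges that it uses. Vertices may repeat on a \<open>line_trail\<close>, links may
  not.\<close>

fun links :: "('v, 'e) elem list \<Rightarrow> ('v, 'e) elem list" where
  "links (x # y # xs) = Link {|x, y|} # links (y # xs)"
| "links _ = []"

definition line_trail :: "('v, 'e) egraph \<Rightarrow> ('v, 'e) elem list \<Rightarrow> bool" where
  "line_trail G p \<longleftrightarrow> p \<noteq> [] \<and> set p \<subseteq> edges G \<and> successively (eadj G) p \<and> distinct (links p)"

lemma links_append: "links (xs @ e # ys) = links (xs @ [e]) @ links (e # ys)"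
  by (induction xs rule: links.induct) auto

lemma links_subset: "l \<in> set (links p) \<Longrightarrow> \<exists>a b. l = Link {|a, b|} \<and> a \<in> set p \<and> b \<in> set p"
  by (induction p rule: links.induct) auto

lemma links_split:
  "l \<in> set (links p) \<Longrightarrow> \<exists>xs a b ys. p = xs @ a # b # ys \<and> l = Link {|a, b|}"
proof (induction p rule: links.induct)
  case (1 x y xs)
  show ?case
  proof (cases "l = Link {|x, y|}")
    case True
    then show ?thesis by (intro exI[of _ "[]"]) auto
  next
    case False
    then obtain us a b ys where "y # xs = us @ a # b # ys" "l = Link {|a, b|}"
      using 1 by auto
    then show ?thesis by (intro exI[of _ "x # us"]) auto
  qed
qed auto

lemma fset_pair_iff: "{|a, b|} = {|c, d|} \<longleftrightarrow> a = c \<and> b = d \<or> a = d \<and> b = c"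
proof -
  have "{|a, b|} = {|c, d|} \<longleftrightarrow> {a, b} = {c, d}"
    by (metis bot_fset.rep_eq finsert.rep_eq fset_inject)
  then show ?thesis by (simp add: doubleton_eq_iff)
qed

lemma distinct_links: "distinct p \<Longrightarrow> distinct (links p)"
proof (induction p rule: links.induct)
  case (1 x y xs)
  have "Link {|x, y|} \<notin> set (links (y # xs))"
    using 1(2) links_subset[of "Link {|x, y|}" "y # xs"] by (auto simp: fset_pair_iff)
  with 1 show ?case by auto
qed auto

text \<open>Only the first and the last link contain \<open>e\<close>, and they differ because the
  first and last entries of \<open>q\<close> do. With a single entry in \<open>q\<close> the same
  link would be used in both directions.\<close>

lemma distinct_links_cycle:
  assumes "distinct (e # q)" "length q \<ge> 2"
  shows "distinct (links (e # q @ [e]))"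
proof -
  obtain a b r where q: "q = a # r @ [b]"
    using assms(2) by (cases q; cases "tl q" rule: rev_cases) auto
  have "links (e # q @ [e]) = Link {|e, a|} # links (a # r @ [b, e])"
    by (simp add: q)
  also have "links (a # r @ [b, e]) = links (a # r @ [b]) @ [Link {|b, e|}]"
    using links_append[of "a # r" b "[e]"] by simp
  finally have *: "links (e # q @ [e]) = Link {|e, a|} # links q @ [Link {|b, e|}]" by (simp add: q)
  have "Link {|e, a|} \<notin> set (links q)" "Link {|b, e|} \<notin> set (links q)"
    using assms(1) links_subset[of "Link {|e, a|}" q] links_subset[of "Link {|b, e|}" q]
    by (auto simp: fset_pair_iff)
  moreover have "a \<noteq> b" "e \<noteq> a" using assms(1) q by auto
  moreover have "distinct (links q)" using assms(1) by (simp add: distinct_links)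
  ultimately show ?thesis unfolding * by (auto simp: fset_pair_iff)
qed

lemma line_graph_simps:
  "verts (line_graph G) = edges G" "ends (line_graph G) (Link S) = fset S"
  by (simp_all add: line_graph_def)

lemma Link_in_edges_iff:
  "Link {|e, f|} \<in> edges (line_graph G) \<longleftrightarrow> e \<in> edges G \<and> f \<in> edges G \<and> eadj G e f"
  by (auto simp: line_graph_def fset_pair_iff eadj_def)

lemma edges_line_graphE:
  assumes "l \<in> edges (line_graph G)"
  obtains e f where "l = Link {|e, f|}" "e \<in> edges G" "f \<in> edges G" "eadj G e f"
    "ends (line_graph G) l = {e, f}"
  using assms by (auto simp: line_graph_def eadj_def)

lemma walk_links:
  assumes "p \<noteq> []" "set p \<subseteq> edges G" "successively (eadj G) p"
  shows "walk (line_graph G) p (links p)"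
  using assms
proof (induction p rule: links.induct)
  case (1 x y xs)
  then show ?case
    by (auto simp: walk_Cons_Cons line_graph_simps Link_in_edges_iff)
qed (auto simp: walk_Nil line_graph_simps)

lemma trail_links: "line_trail G p \<Longrightarrow> trail (line_graph G) p (links p)"
  by (simp add: line_trail_def trail_def walk_links)

text \<open>The list from \<open>trail_edge_list\<close> contains every edge here, so it is a
  hamiltonian path of the line graph. This is one half of the Harary and Nash-Williams criterion,
  for paths.\<close>

lemma traceable_line_graph_dominating:
  assumes "mgraph G" "trail G vs es" "edges G \<noteq> {}" "edges G = \<Union> (inc G ` set vs)"
  shows "traceable (line_graph G)"
proof -
  obtain p where "distinct p" "set p = edges G" "successively (eadj G) p"
    using trail_edge_list[OF assms(1,2)] assms(4) by metis
  then have "hamiltonian_path (line_graph G) p (links p)"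
    using assms(3) by (auto simp: hamiltonian_path_def path_def line_graph_simps intro!: walk_links)
  then show ?thesis by (auto simp: traceable_def)
qed

section \<open>Splicing the edges at a hub into a trail\<close>

text \<open>The link from \<open>e\<close> to \<open>f\<close> gives way to a detour in the clique
  of edges at \<open>w\<close>. Every link of the detour contains an entry of \<open>gs\<close>, and
  none of these was on the trail, so no link is repeated.\<close>

lemma line_trail_insert_between:
  assumes "line_trail G (xs @ e # f # ys)" "distinct gs" "gs \<noteq> []"
    and "set gs \<inter> set (xs @ e # f # ys) = {}" "{e, f} \<union> set gs \<subseteq> inc G w"
  shows "line_trail G (xs @ e # gs @ f # ys)"
proof -
  let ?p = "xs @ e # f # ys"
  have adj: "successively (eadj G) (xs @ [e])" "successively (eadj G) (f # ys)" "eadj G e f"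
    and dl: "distinct (links ?p)" and sub: "set ?p \<subseteq> edges G"
    using assms(1) by (auto simp: line_trail_def successively_append_iff successively_Cons)
  have lp: "links ?p = links (xs @ [e]) @ Link {|e, f|} # links (f # ys)"
    by (simp add: links_append[of xs e "f # ys"])
  have "e \<noteq> f" using adj by (simp add: eadj_def)
  have d: "distinct (e # gs @ [f])" using assms(2,4) \<open>e \<noteq> f\<close> by auto
  have "links (xs @ e # gs @ f # ys) = links (xs @ [e]) @ links (e # gs @ f # ys)"
    by (rule links_append)
  also have "links (e # gs @ f # ys) = links (e # gs @ [f]) @ links (f # ys)"
    using links_append[of "e # gs" f ys] by simp
  finally have l': "links (xs @ e # gs @ f # ys) =
    links (xs @ [e]) @ links (e # gs @ [f]) @ links (f # ys)" .
  have new: "\<exists>g \<in> set gs. \<exists>x. l = Link {|g, x|}" if l: "l \<in> set (links (e # gs @ [f]))" for l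
  proof -
    obtain us a b zs where s: "e # gs @ [f] = us @ a # b # zs" "l = Link {|a, b|}"
      using links_split[OF l] by blast
    have "a \<in> set gs \<or> b \<in> set gs"
    proof (cases us)
      case Nil
      then show ?thesis using s assms(3) by (cases gs) auto
    next
      case (Cons c cs)
      \<comment> \<open>After the first pair, the entry \<open>a\<close> comes later than
        \<open>e\<close> and before the final \<open>f\<close>.\<close>
      then have "butlast (gs @ [f]) = butlast (cs @ a # b # zs)" using s by simp
      then have "gs = cs @ a # butlast (b # zs)" by (simp add: butlast_append)
      then show ?thesis by simp
    qed
    then show ?thesis using s by (metis fset_pair_iff)
  qed
  have old: "Link {|g, x|} \<notin> set (links (xs @ [e]))" "Link {|g, x|} \<notin> set (links (f # ys))"
    if "g \<in> set gs" for g x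
    using that assms(4) links_subset[of "Link {|g, x|}" "xs @ [e]"]
      links_subset[of "Link {|g, x|}" "f # ys"] by (auto simp: fset_pair_iff)
  have "l \<notin> set (links (xs @ [e]))" "l \<notin> set (links (f # ys))"
    if "l \<in> set (links (e # gs @ [f]))" for l
    using new[OF that] old by blast+
  then have "distinct (links (xs @ e # gs @ f # ys))"
    using dl distinct_links[OF d] unfolding l' lp by (auto simp del: links.simps)
  moreover have "successively (eadj G) (e # gs @ [f])"
    by (rule successively_inc[OF d, of _ w]) (use assms(5) in auto)
  then have "successively (eadj G) (xs @ e # gs @ f # ys)"
    using adj \<open>gs \<noteq> []\<close>
    by (auto simp: successively_append_iff successively_Cons hd_append split: if_splits)
  moreover have "set (xs @ e # gs @ f # ys) \<subseteq> edges G"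
    using sub assms(5) inc_subset by fastforce
  ultimately show ?thesis by (simp add: line_trail_def)
qed

text \<open>At a visit of \<open>e\<close> the trail makes a round trip in the clique at
  \<open>w\<close>. Entries of \<open>q\<close> may already be on the trail, as long as the links
  are new.\<close>

lemma line_trail_insert_cycle:
  assumes "line_trail G (xs @ e # ys)" "distinct (e # q)" "length q \<ge> 2" "insert e (set q) \<subseteq> inc G w"
    and "set (links (e # q @ [e])) \<inter> set (links (xs @ e # ys)) = {}"
  shows "line_trail G (xs @ e # q @ e # ys)"
proof -
  have adj: "successively (eadj G) (xs @ [e])" "successively (eadj G) (e # ys)"
    and dl: "distinct (links (xs @ e # ys))" and sub: "set (xs @ e # ys) \<subseteq> edges G"
    using assms(1) by (auto simp: line_trail_def successively_append_iff successively_Cons)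
  have "links (xs @ e # q @ e # ys) = links (xs @ [e]) @ links (e # q @ e # ys)"
    by (rule links_append)
  also have "links (e # q @ e # ys) = links (e # q @ [e]) @ links (e # ys)"
    using links_append[of "e # q" e ys] by simp
  finally have l': "links (xs @ e # q @ e # ys) =
    links (xs @ [e]) @ links (e # q @ [e]) @ links (e # ys)" .
  have lp: "links (xs @ e # ys) = links (xs @ [e]) @ links (e # ys)" by (rule links_append)
  have "distinct (links (xs @ e # q @ e # ys))"
    using dl distinct_links_cycle[OF assms(2,3)] assms(5) unfolding l' lp by auto
  moreover have "successively (eadj G) (e # q)"
    by (rule successively_inc[OF assms(2), of _ w]) (use assms(4) in auto)
  moreover have "q \<noteq> []" using assms(3) by auto
  moreover from this have "eadj G (last q) e"
    by (intro eadj_incI[of _ _ w]) (use assms(2,4) last_in_set in auto)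
  ultimately have "distinct (links (xs @ e # q @ e # ys))" 
    "successively (eadj G) (xs @ e # q @ e # ys)"
    using adj by (auto simp: successively_append_iff successively_Cons split: if_splits)
  moreover have "set (xs @ e # q @ e # ys) \<subseteq> edges G"
    using sub assms(4) inc_subset by fastforce
  ultimately show ?thesis by (simp add: line_trail_def)
qed

lemma line_trail_linkE:
  assumes "line_trail G p" "l \<in> set (links p)"
  obtains a b where "l = Link {|a, b|}" "a \<noteq> b" "a \<in> set p" "b \<in> set p"
proof -
  obtain xs a b ys where s: "p = xs @ a # b # ys" "l = Link {|a, b|}"
    using links_split[OF assms(2)] by blast
  moreover have "a \<noteq> b"
    using assms(1) by (simp add: s line_trail_def successively_append_iff eadj_def)
  ultimately show thesis using that by auto
qed

text \<open>Let \<open>gs\<close> list the missing edges at \<open>w\<close>. If the trail has two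
  edges \<open>e\<close>, \<open>f\<close> at \<open>w\<close>, then \<open>gs\<close> is inserted
  between them when their link is used, and otherwise a cycle through \<open>gs\<close> and
  \<open>f\<close> is attached at \<open>e\<close>. If it has only \<open>e\<close>, a cycle through
  \<open>gs\<close> alone is attached.\<close>

lemma line_trail_absorb:
  assumes "mgraph G" "line_trail G p" "set p \<inter> inc G w \<noteq> {}" "card (inc G w) \<ge> 3"
  shows "\<exists>p'. line_trail G p' \<and> set p' = set p \<union> inc G w"
proof -
  obtain gs where gs: "distinct gs" "set gs = inc G w - set p"
    using finite_distinct_list finite_inc[OF assms(1)] by (metis finite_Diff)
  obtain e where e: "e \<in> set p" "e \<in> inc G w" using assms(3) by blast
  obtain xs ys where p: "p = xs @ e # ys" using e split_list by metis
  show ?thesis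
  proof (cases "gs = []")
    case True
    then show ?thesis using assms(2) gs by (intro exI[of _ p]) auto
  next
    case False
    show ?thesis
    proof (cases "\<exists>f \<in> set p \<inter> inc G w. f \<noteq> e")
      case True
      then obtain f where f: "f \<in> set p" "f \<in> inc G w" "f \<noteq> e" by blast
      show ?thesis
      proof (cases "Link {|e, f|} \<in> set (links p)")
        case True
        then obtain us a b zs where s: "p = us @ a # b # zs" "{a, b} = {e, f}"
          using links_split[OF True] by (auto simp: fset_pair_iff)
        have "line_trail G (us @ a # gs @ b # zs)"
          by (rule line_trail_insert_between[where w = w]) (use assms(2) s gs False e f in auto)
        moreover have "set (us @ a # gs @ b # zs) = set p \<union> inc G w"
          using s gs e f by auto
        ultimately show ?thesis by blast
      next
        case nl: False
        let ?q = "gs @ [f]"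
        have "set (links (e # ?q @ [e])) \<inter> set (links p) = {}"
        proof (rule ccontr)
          assume "\<not> ?thesis"
          then obtain l where l: "l \<in> set (links (e # ?q @ [e]))" "l \<in> set (links p)" by blast
          obtain a b where ab: "l = Link {|a, b|}" "a \<noteq> b" "a \<in> set p" "b \<in> set p"
            using line_trail_linkE[OF assms(2) l(2)] .
          have "a \<in> set (e # ?q @ [e])" "b \<in> set (e # ?q @ [e])"
            using links_subset[OF l(1)] ab(1) by (auto simp: fset_pair_iff)
          then have "a \<in> {e, f}" "b \<in> {e, f}" using ab gs by auto
          then have "l = Link {|e, f|}" using ab by (auto simp: fset_pair_iff)
          with l nl show False by simp
        qed
        then have "line_trail G (xs @ e # ?q @ e # ys)"
          by (intro line_trail_insert_cycle[where w = w])
            (use assms(2) p gs e f False in \<open>auto simp: Suc_le_eq\<close>)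
        moreover have "set (xs @ e # ?q @ e # ys) = set p \<union> inc G w"
          using p gs e f by auto
        ultimately show ?thesis by blast
      qed
    next
      case nf: False
      then have "inc G w = insert e (set gs)" "e \<notin> set gs"
        unfolding gs(2) using e by blast+
      \<comment> \<open>This is where degree three enters: two missing edges are enough to close a
        cycle at \<open>e\<close>.\<close>
      then have "length gs \<ge> 2" using assms(4) distinct_card[OF gs(1)] by simp
      have "set (links (e # gs @ [e])) \<inter> set (links p) = {}"
      proof (rule ccontr)
        assume "\<not> ?thesis"
        then obtain l where l: "l \<in> set (links (e # gs @ [e]))" "l \<in> set (links p)" by blast
        obtain a b where ab: "l = Link {|a, b|}" "a \<noteq> b" "a \<in> set p" "b \<in> set p"
          using line_trail_linkE[OF assms(2) l(2)] .
        have "a \<in> set (e # gs @ [e])" "b \<in> set (e # gs @ [e])"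
          using links_subset[OF l(1)] ab(1) by (auto simp: fset_pair_iff)
        then show False using ab gs by auto
      qed
      then have "line_trail G (xs @ e # gs @ e # ys)"
        by (intro line_trail_insert_cycle[where w = w]) (use assms(2) p gs e \<open>length gs \<ge> 2\<close> in auto)
      moreover have "set (xs @ e # gs @ e # ys) = set p \<union> inc G w"
        using p gs e by auto
      ultimately show ?thesis by blast
    qed
  qed
qed

section \<open>Connectedness by cuts\<close>

text \<open>Connectedness of the subgraph induced by \<open>K\<close>, phrased by cuts so that no
  walks inside \<open>K\<close> have to be built. The empty set and singletons qualify.\<close>

definition cohesive :: "('v, 'e) mgraph \<Rightarrow> 'v set \<Rightarrow> bool" where
  "cohesive G K \<longleftrightarrow> (\<forall>U. U \<subseteq> K \<and> U \<noteq> {} \<and> U \<noteq> K \<longrightarrow>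
     (\<exists>e \<in> edges G. \<exists>u \<in> U. \<exists>v \<in> K - U. ends G e = {u, v}))"

lemma cohesiveD:
  assumes "cohesive G K" "U \<subseteq> K" "U \<noteq> {}" "U \<noteq> K"
  obtains e u v where "e \<in> edges G" "u \<in> U" "v \<in> K - U" "ends G e = {u, v}"
  using assms unfolding cohesive_def by meson

text \<open>A walk from inside \<open>U\<close> to outside has a first edge that leaves
  \<open>U\<close>.\<close>

lemma cohesive_verts:
  assumes "connected_mgraph G"
  shows "cohesive G (verts G)"
  unfolding cohesive_def
proof (intro allI impI)
  fix U assume U: "U \<subseteq> verts G \<and> U \<noteq> {} \<and> U \<noteq> verts G"
  then obtain u v where uv: "u \<in> U" "v \<in> verts G - U" by blast
  then obtain vs es where w: "walk G vs es" "hd vs = u" "last vs = v"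
    using assms U unfolding connected_mgraph_def by (meson DiffD1 subsetD)
  from w uv have "\<exists>e \<in> edges G. \<exists>u \<in> U. \<exists>v \<in> verts G - U. ends G e = {u, v}"
  proof (induction es arbitrary: vs u)
    case Nil
    then show ?case by (auto simp: walk_Nil)
  next
    case (Cons e es)
    then obtain us where us: "vs = u # us"
      by (cases vs) (auto simp: walk_def)
    with Cons.prems have w: "e \<in> edges G" "us \<noteq> []" "ends G e = {u, hd us}" "walk G us es"
      by (auto simp: walk_Cons_Cons)
    show ?case
    proof (cases "hd us \<in> U")
      case True
      then show ?thesis using Cons.IH[OF w(4) refl _ True] Cons.prems us w by auto
    next
      case False
      moreover have "hd us \<in> verts G" using w by (auto simp: walk_def)
      ultimately show ?thesis using w Cons.prems by blast
    qed
  qed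
  then show "\<exists>e \<in> edges G. \<exists>u \<in> U. \<exists>v \<in> verts G - U. ends G e = {u, v}" .
qed

text \<open>Suppose no edge of \<open>U\<close> meets an edge outside \<open>U\<close>, and let
  \<open>?X\<close> be the set of ends of \<open>U\<close>. If \<open>?X\<close> is everything, any
  edge outside \<open>U\<close> meets it; if not, an edge leaving \<open>?X\<close> is outside
  \<open>U\<close> but meets an edge of \<open>U\<close>.\<close>

lemma cohesive_line_graph:
  assumes "mgraph G" "cohesive G (verts G)"
  shows "cohesive (line_graph G) (edges G)"
  unfolding cohesive_def
proof (intro allI impI)
  fix U assume U: "U \<subseteq> edges G \<and> U \<noteq> {} \<and> U \<noteq> edges G"
  have "\<exists>e \<in> U. \<exists>f \<in> edges G - U. ends G e \<inter> ends G f \<noteq> {}"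
  proof (rule ccontr)
    assume no: "\<not> ?thesis"
    let ?X = "\<Union> (ends G ` U)"
    have two: "ends G e \<subseteq> verts G" "ends G e \<noteq> {}" if "e \<in> edges G" for e
      using assms(1) that by (auto simp: mgraph_def)
    obtain e0 f0 where ef0: "e0 \<in> U" "f0 \<in> edges G - U" using U by blast
    then have "?X \<noteq> {}" using two(2)[of e0] U by auto
    have "?X \<subseteq> verts G" using U two(1) by (intro UN_least) auto
    show False
    proof (cases "?X = verts G")
      case True
      obtain v where v: "v \<in> ends G f0" "v \<in> verts G" using two[of f0] ef0 by auto
      then obtain e where "e \<in> U" "v \<in> ends G e" using True by auto
      then show False using no ef0(2) v(1) by auto
    next
      case False
      obtain e u v where e: "e \<in> edges G" "u \<in> ?X" "v \<in> verts G - ?X" "ends G e = {u, v}"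
        by (rule cohesiveD[OF assms(2) \<open>?X \<subseteq> verts G\<close> \<open>?X \<noteq> {}\<close> False])
      obtain f where "f \<in> U" "u \<in> ends G f" using e(2) by auto
      moreover have "e \<notin> U" using e(3,4) by auto
      ultimately show False using no e(1,4) by auto
    qed
  qed
  then obtain e f where ef: "e \<in> U" "f \<in> edges G - U" "ends G e \<inter> ends G f \<noteq> {}" by blast
  then have "Link {|e, f|} \<in> edges (line_graph G)"
    using U by (auto simp: Link_in_edges_iff eadj_def)
  moreover have "ends (line_graph G) (Link {|e, f|}) = {e, f}" by (simp add: line_graph_simps)
  ultimately show "\<exists>l \<in> edges (line_graph G). \<exists>u \<in> U. \<exists>v \<in> edges G - U. ends (line_graph G) l = {u, v}"
    using ef(1,2) by blast
qed

section \<open>Distance in a graph and in its line graph\<close>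

text \<open>Distance at most \<open>n\<close>: reflexivity is granted for every \<open>n\<close>,
  which makes the relation monotone in \<open>n\<close>.\<close>

inductive near :: "('v, 'e) mgraph \<Rightarrow> nat \<Rightarrow> 'v \<Rightarrow> 'v \<Rightarrow> bool" for G where
  near_refl: "near G n u u"
| near_step: "e \<in> edges G \<Longrightarrow> ends G e = {u, x} \<Longrightarrow> near G n x w \<Longrightarrow> near G (Suc n) u w"

lemma near_mono: "near G n u w \<Longrightarrow> n \<le> n' \<Longrightarrow> near G n' u w"
proof (induction arbitrary: n' rule: near.induct)
  case (near_step e u x n w)
  then obtain k where "n' = Suc k" "n \<le> k" by (cases n') auto
  with near_step show ?case by (auto intro: near.near_step)
qed (rule near_refl)

lemma near_0: "near G 0 u w \<longleftrightarrow> u = w"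
  by (auto elim: near.cases intro: near_refl)

lemma near_snoc: "near G n u x \<Longrightarrow> e \<in> edges G \<Longrightarrow> ends G e = {x, w} \<Longrightarrow> near G (Suc n) u w"
proof (induction rule: near.induct)
  case (near_refl n u)
  then show ?case by (meson near.near_refl near.near_step)
qed (auto intro: near_step)

lemma near_edge: "e \<in> edges G \<Longrightarrow> ends G e = {u, w} \<Longrightarrow> near G (Suc n) u w"
  by (meson near_refl near_step)

lemma near_sym: "near G n u w \<Longrightarrow> near G n w u"
proof (induction rule: near.induct)
  case (near_step e u x n w)
  then show ?case by (intro near_snoc[of G n w x e]) (auto simp: insert_commute)
qed (rule near_refl)

lemma near_SucE:
  assumes "near G n u w" "u \<noteq> w"
  obtains e x k where "n = Suc k" "e \<in> edges G" "ends G e = {u, x}" "near G k x w"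
  using assms by (auto elim: near.cases)

lemma Link_inc_in_edges:
  assumes "e \<in> inc G v" "f \<in> inc G v" "e \<noteq> f"
  shows "Link {|e, f|} \<in> edges (line_graph G)"
  using eadj_incI[OF assms] assms(1,2) by (simp add: Link_in_edges_iff inc_def)

lemma near_line_graph_adj:
  assumes "e \<in> inc G v" "f \<in> inc G v"
  shows "near (line_graph G) (Suc n) e f"
proof (cases "e = f")
  case False
  then have "Link {|e, f|} \<in> edges (line_graph G)"
    using Link_inc_in_edges assms by metis
  then show ?thesis by (rule near_edge) (simp add: line_graph_simps)
qed (simp add: near_refl)

text \<open>The edges of a walk of length \<open>n\<close> from \<open>x\<close> to
  \<open>y\<close>, placed between \<open>e\<close> and \<open>f\<close>, form a walk with one step
  more; coinciding neighbours only shorten it.\<close>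

lemma near_line_graph:
  assumes "near G n x y" "e \<in> inc G x" "f \<in> inc G y"
  shows "near (line_graph G) (Suc n) e f"
  using assms
proof (induction arbitrary: e rule: near.induct)
  case (near_refl n u)
  then show ?case by (rule near_line_graph_adj)
next
  case (near_step g x z n y)
  then have g: "g \<in> inc G x" "g \<in> inc G z" by (auto simp: inc_def)
  have *: "near (line_graph G) (Suc n) g f" using near_step.IH[OF g(2)] near_step.prems by blast
  show ?case
  proof (cases "e = g")
    case True
    with * show ?thesis by (simp add: near_mono)
  next
    case False
    then have "Link {|e, g|} \<in> edges (line_graph G)"
      using Link_inc_in_edges near_step.prems(1) g(1) by metis
    then show ?thesis by (rule near.near_step[OF _ _ *]) (simp add: line_graph_simps)
  qed
qed

section \<open>Hubs, the invariant and degrees in the line graph\<close>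

definition hubs :: "('v, 'e) mgraph \<Rightarrow> 'v list \<Rightarrow> 'v set" where
  "hubs G vs = set vs \<union> {v \<in> verts G. card (inc G v) \<ge> 3}"

text \<open>The invariant that drops from \<open>Suc p\<close> to \<open>p\<close> when passing to the line graph; for \<open>p = 0\<close> it
  says that all hubs lie on the trail and that the trail dominates all edges.\<close>

definition reducible :: "('v, 'e) mgraph \<Rightarrow> 'v list \<Rightarrow> nat \<Rightarrow> bool" where
  "reducible G vs p \<longleftrightarrow>
    (\<forall>K. K \<subseteq> verts G - hubs G vs \<and> cohesive G K \<longrightarrow> card K \<le> Suc p) \<and>
    (\<forall>U. set vs \<subseteq> U \<and> (\<forall>u \<in> U \<inter> hubs G vs. \<forall>w \<in> hubs G vs. near G p u w \<longrightarrow> w \<in> U)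
      \<longrightarrow> hubs G vs \<subseteq> U)"

lemma card_inc_line_graph:
  assumes "e \<in> edges G"
  shows "card (inc (line_graph G) e) = card {f \<in> edges G. eadj G e f}"
proof -
  have "inc (line_graph G) e = (\<lambda>f. Link {|e, f|}) ` {f \<in> edges G. eadj G e f}"
  proof (intro set_eqI iffI)
    fix l assume "l \<in> inc (line_graph G) e"
    then obtain a b where "l = Link {|a, b|}" "a \<in> edges G" "b \<in> edges G" "eadj G a b" "e \<in> {a, b}"
      by (auto simp: inc_def elim: edges_line_graphE)
    then show "l \<in> (\<lambda>f. Link {|e, f|}) ` {f \<in> edges G. eadj G e f}"
      by (auto simp: eadj_sym fset_pair_iff)
  qed (use assms in \<open>auto simp: inc_def Link_in_edges_iff line_graph_simps\<close>)
  moreover have "inj_on (\<lambda>f. Link {|e, f|}) A" for A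
    by (auto simp: inj_on_def fset_pair_iff)
  ultimately show ?thesis by (simp add: card_image)
qed

lemma eadj_set:
  assumes "ends G e = {u, x}"
  shows "{f \<in> edges G. eadj G e f} = inc G u \<union> inc G x - {e}"
  using assms by (auto simp: eadj_def inc_def)

section \<open>Absorbing hubs\<close>

text \<open>Take an inclusion-maximal set \<open>A\<close> of hubs, containing the trail, whose
  edges are exactly those visited by some \<open>line_trail\<close>. A hub outside \<open>A\<close>
  has degree at least three, so if one of its edges were visited, \<open>line_trail_absorb\<close>
  would enlarge \<open>A\<close>.\<close>

lemma maximal_absorption:
  assumes "mgraph G" "trail G vs es" "\<Union> (inc G ` set vs) \<noteq> {}"
  obtains A q where "set vs \<subseteq> A" "A \<subseteq> hubs G vs" "line_trail G q" "set q = \<Union> (inc G ` A)"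
    "\<And>w. w \<in> hubs G vs - A \<Longrightarrow> inc G w \<inter> set q = {}"
proof -
  define F where "F = {A. set vs \<subseteq> A \<and> A \<subseteq> hubs G vs \<and> (\<exists>q. line_trail G q \<and> set q = \<Union> (inc G ` A))}"
  obtain p where p: "distinct p" "set p = \<Union> (inc G ` set vs)" "successively (eadj G) p"
    using trail_edge_list[OF assms(1,2)] .
  have "p \<noteq> []" using p(2) assms(3) by auto
  moreover have "set p \<subseteq> edges G" unfolding p(2) using inc_subset by (intro UN_least)
  ultimately have "line_trail G p" using p by (simp add: line_trail_def distinct_links)
  then have "set vs \<in> F" unfolding F_def using p(2) by (auto simp: hubs_def intro!: exI[of _ p])
  moreover have "finite (hubs G vs)"
    using assms(1) by (auto simp: hubs_def mgraph_def)
  then have "finite (Pow (hubs G vs))" by simp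
  then have "finite F" by (rule rev_finite_subset) (auto simp: F_def)
  ultimately obtain A where A: "A \<in> F" and max: "\<And>B. B \<in> F \<Longrightarrow> A \<subseteq> B \<Longrightarrow> A = B"
    using finite_has_maximal[of F] by (metis empty_iff)
  from A obtain q where q: "line_trail G q" "set q = \<Union> (inc G ` A)" unfolding F_def by blast
  have A': "set vs \<subseteq> A" "A \<subseteq> hubs G vs" using A by (auto simp: F_def)
  show thesis
  proof (rule that[OF A' q])
    fix w assume w: "w \<in> hubs G vs - A"
    show "inc G w \<inter> set q = {}"
    proof (rule ccontr)
      assume "inc G w \<inter> set q \<noteq> {}"
      then have "set q \<inter> inc G w \<noteq> {}" by blast
      moreover have "card (inc G w) \<ge> 3" using w A' by (auto simp: hubs_def)
      ultimately obtain q' where q': "line_trail G q'" "set q' = set q \<union> inc G w"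
        using line_trail_absorb[OF assms(1) q(1), of w] by metis
      have "set q' = \<Union> (inc G ` insert w A)" using q' q by auto
      then have "insert w A \<in> F" unfolding F_def using A' w q'(1) by blast
      then show False using max[of "insert w A"] w by blast
    qed
  qed
qed

section \<open>Connected sets of edges and their ends\<close>

text \<open>If no edge of \<open>K\<close> crosses the cut \<open>U\<close>, the edges of
  \<open>K\<close> meeting \<open>U\<close> are a proper nonempty part of \<open>K\<close>. One of
  them, \<open>a\<close>, shares an end \<open>x\<close> with an edge of \<open>K\<close> missing
  \<open>U\<close>; then \<open>x\<close> is outside \<open>U\<close> and \<open>a\<close> crosses
  after all.\<close>

lemma cohesive_Union_ends:
  assumes "mgraph G" "K \<subseteq> edges G" "cohesive (line_graph G) K"
  shows "cohesive G (\<Union> (ends G ` K))"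
  unfolding cohesive_def
proof (intro allI impI)
  let ?W = "\<Union> (ends G ` K)"
  fix U assume U: "U \<subseteq> ?W \<and> U \<noteq> {} \<and> U \<noteq> ?W"
  show "\<exists>e \<in> edges G. \<exists>u \<in> U. \<exists>v \<in> ?W - U. ends G e = {u, v}"
  proof (cases "\<exists>e \<in> K. \<exists>u \<in> U. \<exists>v. v \<in> ends G e \<and> u \<in> ends G e \<and> v \<notin> U")
    case True
    then obtain e u v where e: "e \<in> K" "u \<in> U" "v \<in> ends G e" "u \<in> ends G e" "v \<notin> U" by blast
    then have "e \<in> inc G u" using assms(2) by (auto simp: inc_def)
    then obtain x where "ends G e = {u, x}" using ends_obtain[OF assms(1)] by metis
    then have "ends G e = {u, v}" using e by auto
    then show ?thesis using e assms(2) by blast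
  next
    case no: False
    let ?K = "{e \<in> K. ends G e \<inter> U \<noteq> {}}"
    obtain u v where u: "u \<in> U" "u \<in> ?W" and v: "v \<in> ?W" "v \<notin> U" using U by blast
    obtain e where e: "e \<in> K" "u \<in> ends G e" using u(2) by auto
    then have "?K \<noteq> {}" using u(1) by auto
    obtain f where "f \<in> K" "v \<in> ends G f" using v(1) by auto
    then have "f \<in> K" "f \<notin> ?K" using no v(2) by auto
    then have "?K \<noteq> K" by auto
    then obtain l a b where l: "l \<in> edges (line_graph G)" "a \<in> ?K" "b \<in> K - ?K"
      "ends (line_graph G) l = {a, b}"
      using cohesiveD[OF assms(3), of ?K] \<open>?K \<noteq> {}\<close> by auto
    obtain c d where "eadj G c d" "ends (line_graph G) l = {c, d}"
      using edges_line_graphE[OF l(1)] by metis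
    then have "eadj G a b" using l(4) eadj_sym by (metis doubleton_eq_iff)
    then obtain x where x: "x \<in> ends G a" "x \<in> ends G b" by (auto simp: eadj_def)
    have "x \<notin> U" using x l(3) by auto
    moreover obtain y where "y \<in> ends G a" "y \<in> U" using l(2) by auto
    ultimately show ?thesis using no x(1) l(2) by auto
  qed
qed

text \<open>Double counting: twice \<open>card K\<close> is the sum of the \<open>K\<close>-degrees
  over the ends. Each is at most two, and one is smaller because an edge \<open>g\<close> leaves the
  set of ends. This is how a chain of vertices of degree at most two loses a vertex.\<close>

lemma card_edges_less_card_ends:
  assumes "mgraph G" "cohesive G (verts G)" "K \<subseteq> edges G" "K \<noteq> {}"
    and "\<Union> (ends G ` K) \<noteq> verts G" "\<And>v. v \<in> \<Union> (ends G ` K) \<Longrightarrow> card (inc G v) \<le> 2"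
  shows "card K < card (\<Union> (ends G ` K))"
proof -
  let ?W = "\<Union> (ends G ` K)"
  have two: "ends G e \<subseteq> verts G" "card (ends G e) = 2" if "e \<in> K" for e
    using assms(1,3) that by (auto simp: mgraph_def)
  have fin: "finite K" "finite (verts G)"
    using assms(1,3) by (auto simp: mgraph_def intro: finite_subset)
  have W: "?W \<subseteq> verts G" using two(1) by (intro UN_least)
  then have finW: "finite ?W" using fin(2) finite_subset by blast
  obtain e0 where e0: "e0 \<in> K" using assms(4) by blast
  then have "ends G e0 \<noteq> {}" using two(2)[of e0] by auto
  then have "?W \<noteq> {}" using e0 by auto
  then obtain g u v where g: "g \<in> edges G" "u \<in> ?W" "v \<in> verts G - ?W" "ends G g = {u, v}"
    using cohesiveD[OF assms(2) W _ assms(5)] by metis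
  have sub: "{e \<in> K. w \<in> ends G e} \<subseteq> inc G w" for w using assms(3) by (auto simp: inc_def)
  have le: "card {e \<in> K. w \<in> ends G e} \<le> 2" if "w \<in> ?W" for w
    using card_mono[OF finite_inc[OF assms(1)] sub, of w] assms(6)[OF that] by simp
  have "g \<notin> K" using g(3,4) by auto
  then have "{e \<in> K. u \<in> ends G e} \<subset> inc G u" using sub[of u] g(1,4) by (auto simp: inc_def)
  then have lt: "card {e \<in> K. u \<in> ends G e} < 2"
    using psubset_card_mono[OF finite_inc[OF assms(1)]] assms(6)[OF g(2)] order_less_le_trans by blast
  have "(\<Sum>w\<in>?W. card {e \<in> K. w \<in> ends G e}) = (\<Sum>e\<in>K. 2)"
  proof (rule sum_multicount_gen[OF finW fin(1)], rule ballI)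
    fix e assume "e \<in> K"
    then have "{w \<in> ?W. w \<in> ends G e} = ends G e" by auto
    then show "card {w \<in> ?W. w \<in> ends G e} = 2" using two(2)[OF \<open>e \<in> K\<close>] by simp
  qed
  moreover have "(\<Sum>w\<in>?W. card {e \<in> K. w \<in> ends G e}) < (\<Sum>w\<in>?W. 2)"
    by (rule sum_strict_mono_ex1[OF finW]) (use le lt g(2) in auto)
  ultimately show ?thesis by simp
qed

text \<open>The neighbours of \<open>e\<close> include at least two further edges at
  \<open>u\<close> and an edge at \<open>x\<close> that avoids \<open>u\<close>. The excluded case
  is that all edges at \<open>x\<close> are parallel to \<open>e\<close>.\<close>

lemma hubs_line_graphI:
  assumes "mgraph G" "e \<in> edges G" "ends G e = {u, x}" "card (inc G u) \<ge> 3" "\<not> inc G x \<subseteq> inc G u"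
  shows "e \<in> hubs (line_graph G) q"
proof -
  obtain g where g: "g \<in> inc G x" "g \<notin> inc G u" using assms(5) by blast
  have e: "e \<in> inc G u" using assms(2,3) by (auto simp: inc_def)
  have fin: "finite (inc G u)" "finite (inc G x)" using assms(1) by (simp_all add: finite_inc)
  have "3 \<le> card (insert g (inc G u - {e}))"
    using assms(4) g fin e by (simp add: card_insert_if)
  also have "\<dots> \<le> card (inc G u \<union> inc G x - {e})"
    by (rule card_mono) (use fin g e in auto)
  finally show ?thesis
    using assms(2,3) by (simp add: hubs_def line_graph_simps card_inc_line_graph eadj_set)
qed

text \<open>If both ends had degree at most two, \<open>e\<close> would have at most one neighbour
  at each of them.\<close>

lemma hubs_line_graph_ends:
  assumes "mgraph G" "e \<in> edges G" "card (inc (line_graph G) e) \<ge> 3"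
  obtains u where "u \<in> verts G" "card (inc G u) \<ge> 3" "e \<in> inc G u"
proof -
  have "card (ends G e) = 2" using assms(1,2) by (auto simp: mgraph_def)
  then obtain u x where ux: "ends G e = {u, x}" by (meson card_2_iff)
  have e: "e \<in> inc G u" "e \<in> inc G x" using assms(2) ux by (auto simp: inc_def)
  have fin: "finite (inc G u)" "finite (inc G x)" using assms(1) by (simp_all add: finite_inc)
  have "3 \<le> card (inc G u \<union> inc G x - {e})"
    using assms(2,3) ux by (simp add: card_inc_line_graph eadj_set)
  also have "inc G u \<union> inc G x - {e} = (inc G u - {e}) \<union> (inc G x - {e})" by auto
  also have "card \<dots> \<le> card (inc G u - {e}) + card (inc G x - {e})" by (rule card_Un_le)
  finally have "3 \<le> card (inc G u) \<or> 3 \<le> card (inc G x)"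
    using e fin by (simp add: card_Diff_singleton_if; linarith)
  moreover have "u \<in> verts G" "x \<in> verts G"
    using assms(1,2) ux by (auto simp: mgraph_def)
  ultimately show thesis using that e by blast
qed

lemma Union_inc_nonempty:
  assumes "cohesive G (verts G)" "trail G vs es" "edges G \<noteq> {}" "mgraph G"
  shows "\<Union> (inc G ` set vs) \<noteq> {}"
proof -
  have vs: "set vs \<subseteq> verts G" "set vs \<noteq> {}" using assms(2) by (auto simp: trail_def walk_def)
  show ?thesis
  proof (cases "set vs = verts G")
    case True
    obtain e where e: "e \<in> edges G" using assms(3) by blast
    then have "ends G e \<noteq> {}" "ends G e \<subseteq> verts G" using assms(4) by (auto simp: mgraph_def)
    then obtain v where "v \<in> set vs" "e \<in> inc G v" using e True by (auto simp: inc_def)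
    then show ?thesis by blast
  next
    case False
    obtain e u v where "e \<in> edges G" "u \<in> set vs" "ends G e = {u, v}"
      using cohesiveD[OF assms(1) vs False] by metis
    then show ?thesis by (auto simp: inc_def)
  qed
qed


lemma reducible_cohesiveD:
  "reducible G vs p \<Longrightarrow> K \<subseteq> verts G - hubs G vs \<Longrightarrow> cohesive G K \<Longrightarrow> card K \<le> Suc p"
  unfolding reducible_def by simp

lemma reducible_hubsD:
  assumes "reducible G vs p" "set vs \<subseteq> U"
    and "\<And>u w. u \<in> U \<inter> hubs G vs \<Longrightarrow> w \<in> hubs G vs \<Longrightarrow> near G p u w \<Longrightarrow> w \<in> U"
  shows "hubs G vs \<subseteq> U"
  using assms unfolding reducible_def by simp

text \<open>An edge from a member of \<open>A\<close> to a hub lies on \<open>q\<close>, so that hub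
  is in \<open>A\<close>. Thus \<open>A\<close> is closed under steps of length one between hubs,
  the range of the invariant here.\<close>

lemma maximal_absorption_all:
  assumes "reducible G vs (Suc 0)" "set vs \<subseteq> A" "set q = \<Union> (inc G ` A)"
    and closed: "\<And>w. w \<in> hubs G vs - A \<Longrightarrow> inc G w \<inter> set q = {}"
  shows "hubs G vs \<subseteq> A"
proof -
  have "w \<in> A" if h: "u \<in> A" "w \<in> hubs G vs" "near G (Suc 0) u w" for u w
  proof (rule ccontr)
    assume "w \<notin> A"
    then have "u \<noteq> w" using h by auto
    then obtain e where e: "e \<in> edges G" "ends G e = {u, w}"
      using near_SucE[OF h(3)] by (metis near_0 nat.inject)
    then have "e \<in> inc G w" "e \<in> inc G u" by (auto simp: inc_def)
    then show False using closed[of w] h(1,2) \<open>w \<notin> A\<close> assms(3) by blast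
  qed
  then show ?thesis using reducible_hubsD[OF assms(1,2)] by blast
qed

text \<open>Let \<open>?W\<close> be the set of ends of \<open>K\<close>. Without hubs,
  \<open>?W\<close> is a connected set bounded by the invariant, and \<open>K\<close> is smaller. If
  \<open>?W\<close> contains a hub \<open>u\<close>, parallel edges force \<open>K\<close> to be a
  proper part of the three edges at \<open>u\<close>, and two is within the bound unless
  \<open>p = 0\<close>.\<close>

lemma reducible_line_graph_cohesive:
  assumes G: "mgraph G" "cohesive G (verts G)" and red: "reducible G vs (Suc p)"
    and A: "set vs \<subseteq> A" "A \<subseteq> hubs G vs" "set q = \<Union> (inc G ` A)"
    and closed: "\<And>w. w \<in> hubs G vs - A \<Longrightarrow> inc G w \<inter> set q = {}"
    and vs: "vs \<noteq> []" "set vs \<subseteq> verts G"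
    and K: "K \<subseteq> edges G - hubs (line_graph G) q" "cohesive (line_graph G) K"
  shows "card K \<le> Suc p"
proof (cases "K = {}")
  case False
  let ?W = "\<Union> (ends G ` K)"
  have KE: "K \<subseteq> edges G" using K(1) by blast
  then have W: "?W \<subseteq> verts G" using G(1) by (intro UN_least) (auto simp: mgraph_def)
  have Kq: "e \<notin> set q" if "e \<in> K" for e using K(1) that by (auto simp: hubs_def)
  have WA: "v \<notin> A" if v: "v \<in> ?W" for v
  proof
    assume "v \<in> A"
    obtain e where "e \<in> K" "v \<in> ends G e" using v by auto
    then have "e \<in> inc G v" using KE by (auto simp: inc_def)
    then show False using \<open>v \<in> A\<close> A(3) Kq[OF \<open>e \<in> K\<close>] by auto
  qed
  have "hd vs \<in> A" "hd vs \<in> verts G" using vs A(1) by (auto simp: subset_iff)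
  then have Wne: "?W \<noteq> verts G" using WA by blast
  show ?thesis
  proof (cases "?W \<inter> hubs G vs = {}")
    case True
    have "card (inc G v) \<le> 2" if "v \<in> ?W" for v
      using True that W by (force simp: hubs_def)
    then have "card K < card ?W" using card_edges_less_card_ends[OF G KE False Wne] by blast
    moreover have "?W \<subseteq> verts G - hubs G vs" using True W by blast
    then have "card ?W \<le> Suc (Suc p)"
      using red cohesive_Union_ends[OF G(1) KE K(2)] unfolding reducible_def by blast
    ultimately show ?thesis by simp
  next
    case False
    then obtain u where u: "u \<in> ?W" "u \<in> hubs G vs" by blast
    then obtain e where e: "e \<in> K" "u \<in> ends G e" by auto
    then have eu: "e \<in> inc G u" using KE by (auto simp: inc_def)
    have "u \<notin> A" using WA u by blast
    then have u3: "card (inc G u) \<ge> 3" using u A(1) by (auto simp: hubs_def)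
    have "p \<noteq> 0"
    proof
      assume "p = 0"
      then have "hubs G vs \<subseteq> A" using maximal_absorption_all[OF _ A(1,3) closed] red by simp
      then show False using u \<open>u \<notin> A\<close> by blast
    qed
    \<comment> \<open>Otherwise \<open>f\<close> would have degree at least three in the line graph
      and be a hub.\<close>
    have other: "inc G y \<subseteq> inc G u" if "f \<in> K" "ends G f = {u, y}" for f y
      using hubs_line_graphI[OF G(1) _ that(2) u3] that(1) K(1) by blast
    obtain x where x: "ends G e = {u, x}" using ends_obtain[OF G(1) eu] by metis
    have "card (inc (line_graph G) e) < 3" using e(1) K(1) by (auto simp: hubs_def line_graph_simps)
    then have "card (inc G u \<union> inc G x - {e}) < 3"
      using e(1) KE x by (simp add: card_inc_line_graph eadj_set subset_iff)
    moreover have "inc G u \<union> inc G x - {e} = inc G u - {e}" using other[OF e(1) x] by blast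
    ultimately have c3: "card (inc G u) \<le> 3"
      using eu finite_inc[OF G(1), of u] by (simp add: card_Diff_singleton_if)
    \<comment> \<open>To leave the edges at \<open>u\<close>, the connected set \<open>K\<close>
      would need an edge at a neighbour \<open>y\<close> that avoids \<open>u\<close>, contrary to
      \<open>other\<close>.\<close>
    have Ku: "K \<subseteq> inc G u"
    proof (rule ccontr)
      assume "\<not> K \<subseteq> inc G u"
      then have U: "K \<inter> inc G u \<subseteq> K" "K \<inter> inc G u \<noteq> {}" "K \<inter> inc G u \<noteq> K" using e eu by auto
      obtain l a b where l: "l \<in> edges (line_graph G)" "a \<in> K \<inter> inc G u" "b \<in> K - K \<inter> inc G u"
        "ends (line_graph G) l = {a, b}" by (rule cohesiveD[OF K(2) U])
      obtain c d where "eadj G c d" "ends (line_graph G) l = {c, d}"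
        using edges_line_graphE[OF l(1)] by metis
      then have "eadj G a b" using l(4) eadj_sym by (metis doubleton_eq_iff)
      then obtain z where z: "z \<in> ends G a" "z \<in> ends G b" by (auto simp: eadj_def)
      then have "b \<in> inc G z" using l(3) KE by (auto simp: inc_def)
      obtain y where y: "ends G a = {u, y}" using ends_obtain[OF G(1)] l(2) by (metis IntD2)
      then have "z = u \<or> z = y" using z(1) by auto
      then have "inc G z \<subseteq> inc G u" using other[OF _ y] l(2) by auto
      then show False using \<open>b \<in> inc G z\<close> l(3) by blast
    qed
    \<comment> \<open>If \<open>K\<close> were all edges at \<open>u\<close>, then by
      \<open>other\<close> no edge could leave \<open>?W\<close>, although \<open>G\<close> is
      connected and \<open>?W\<close> misses the trail.\<close>
    have "K \<noteq> inc G u"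
    proof
      assume Keq: "K = inc G u"
      have "?W \<noteq> {}" using u by blast
      then obtain g a b where g: "g \<in> edges G" "a \<in> ?W" "b \<in> verts G - ?W" "ends G g = {a, b}"
        using cohesiveD[OF G(2) W _ Wne] by metis
      obtain f where f: "f \<in> K" "a \<in> ends G f" using g(2) by auto
      obtain y where y: "ends G f = {u, y}" using ends_obtain[OF G(1)] f(1) Keq by metis
      then have "a = u \<or> a = y" using f(2) by auto
      then have "inc G a \<subseteq> inc G u" using other[OF f(1) y] by auto
      moreover have "g \<in> inc G a" using g by (auto simp: inc_def)
      ultimately have "g \<in> K" using Keq by blast
      then show False using g(3,4) by auto
    qed
    then have "card K < card (inc G u)"
      using Ku psubset_card_mono[OF finite_inc[OF G(1)]] by blast
    with c3 \<open>p \<noteq> 0\<close> show ?thesis by simp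
  qed
qed simp

section \<open>Closeness of hubs in the line graph\<close>

text \<open>Induction along a walk between two hubs. A step to a neighbour all of whose edges return to
  the current hub is undone by the walk; every other edge at a hub becomes a hub of the line graph.\<close>

lemma hubs_line_graph_transfer:
  assumes G: "mgraph G"
    and A: "set vs \<subseteq> A" "set q = \<Union> (inc G ` A)"
    and U: "\<forall>e \<in> U \<inter> hubs (line_graph G) q. \<forall>f \<in> hubs (line_graph G) q.
      near (line_graph G) p e f \<longrightarrow> f \<in> U"
    and "p \<noteq> 0"
    and "near G d u w" "d \<le> Suc p" "u \<in> hubs G vs" "w \<in> hubs G vs"
    and "inc G u \<inter> hubs (line_graph G) q \<subseteq> U"
  shows "inc G w \<inter> hubs (line_graph G) q \<subseteq> U"
  using assms(6-10)
proof (induction d arbitrary: u w rule: less_induct)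
  case (less d)
  let ?H = "hubs (line_graph G) q"
  \<comment> \<open>At a vertex of the trail every edge is visited by \<open>q\<close>, hence a hub
    whatever its degree.\<close>
  have hubI: "e \<in> ?H" if "e \<in> edges G" "ends G e = {u, x}" "u \<in> hubs G vs" "\<not> inc G x \<subseteq> inc G u" for e u x
  proof (cases "u \<in> set vs")
    case True
    then have "e \<in> set q" using that A by (auto simp: inc_def)
    then show ?thesis by (simp add: hubs_def)
  next
    case False
    then show ?thesis using hubs_line_graphI[OF G that(1,2) _ that(4)] that(3) by (auto simp: hubs_def)
  qed
  \<comment> \<open>Edges with a common end are at distance at most one, and \<open>p\<close> is at
    least one.\<close>
  have all: "inc G v \<inter> ?H \<subseteq> U" if "e \<in> inc G v" "e \<in> U" "e \<in> ?H" for e v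
  proof -
    obtain k where "p = Suc k" using \<open>p \<noteq> 0\<close> by (cases p) auto
    then show ?thesis using that U near_line_graph_adj[OF that(1)] by blast
  qed
  show ?case
  proof (cases "u = w")
    case True
    then show ?thesis using less.prems by simp
  next
    case False
    obtain e x k where e: "d = Suc k" "e \<in> edges G" "ends G e = {u, x}" "near G k x w"
      using near_SucE[OF less.prems(1) False] .
    have ei: "e \<in> inc G u" "e \<in> inc G x" using e by (auto simp: inc_def)
    show ?thesis
    proof (cases "x \<in> hubs G vs")
      case True
      have "inc G x \<inter> ?H \<subseteq> U"
      proof (cases "inc G x \<subseteq> inc G u")
        case True
        then show ?thesis using less.prems(5) by blast
      next
        case False
        then have "e \<in> ?H" using hubI e less.prems(3) by blast
        then show ?thesis using all[OF ei(2)] ei(1) less.prems(5) by blast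
      qed
      then show ?thesis using less.IH[of k x w] e True less.prems by simp
    next
      case False
      then have "x \<noteq> w" using less.prems by blast
      show ?thesis
      proof (cases "inc G x \<subseteq> inc G u")
        case True
        \<comment> \<open>The walk must return from \<open>x\<close> to \<open>u\<close>, so its
          remainder is a shorter walk from \<open>u\<close> to \<open>w\<close>.\<close>
        obtain g z k' where g: "k = Suc k'" "g \<in> edges G" "ends G g = {x, z}" "near G k' z w"
          using near_SucE[OF e(4) \<open>x \<noteq> w\<close>] .
        have gi: "g \<in> inc G x" "g \<in> inc G z" using g by (auto simp: inc_def)
        then have "u \<in> {x, z}" using True g(3) by (auto simp: inc_def)
        moreover have "u \<noteq> x" using False less.prems by blast
        ultimately have "z = u" by auto
        then show ?thesis using less.IH[of k' u w] g e less.prems by simp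
      next
        case nx: False
        have eH: "e \<in> ?H" using hubI e less.prems(3) nx by blast
        then have eU: "e \<in> U" using ei(1) less.prems(5) by blast
        \<comment> \<open>Now the walk is examined from its other end; \<open>f\<close> is an edge
          at \<open>w\<close>, and \<open>k'\<close> is \<open>d - 2\<close>.\<close>
        obtain f y k' where f: "k = Suc k'" "f \<in> edges G" "ends G f = {w, y}" "near G k' y x"
          using near_SucE[OF near_sym[OF e(4)]] \<open>x \<noteq> w\<close> by metis
        have fi: "f \<in> inc G w" "f \<in> inc G y" using f by (auto simp: inc_def)
        have uy: "near G k u y" unfolding f(1) by (rule near_step[OF e(2,3) near_sym[OF f(4)]])
        show ?thesis
        proof (cases "y \<in> hubs G vs")
          case True
          then have "inc G y \<inter> ?H \<subseteq> U" using less.IH[OF _ uy] e less.prems by simp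
          moreover have "near G 1 y w"
            using near_edge[OF f(2), of y w 0] f(3) by (simp add: insert_commute)
          ultimately show ?thesis
            using less.IH[of 1 y w] e f True less.prems by simp
        next
          case False
          show ?thesis
          proof (cases "inc G y \<subseteq> inc G w")
            case True
            show ?thesis
            proof (cases "y = x")
              case True
              then have "w \<in> {u, x}" using \<open>inc G y \<subseteq> inc G w\<close> ei(2) e(3) by (auto simp: inc_def)
              then show ?thesis using \<open>x \<noteq> w\<close> \<open>u \<noteq> w\<close> by auto
            next
              case False
              \<comment> \<open>All edges at \<open>y\<close> lead to \<open>w\<close>, so the
                reversed walk goes back to \<open>w\<close> and can be shortened by two
                steps.\<close>
              obtain g z k'' where g: "k' = Suc k''" "g \<in> edges G" "ends G g = {y, z}" "near G k'' z x"
                using near_SucE[OF f(4) False] .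
              have "g \<in> inc G y" using g by (auto simp: inc_def)
              then have "w \<in> {y, z}" using \<open>inc G y \<subseteq> inc G w\<close> g(3) by (auto simp: inc_def)
              moreover have "w \<noteq> y" using \<open>y \<notin> hubs G vs\<close> less.prems by blast
              ultimately have "near G k'' w x" using g(4) by auto
              then have "near G (Suc k'') u w" using near_step[OF e(2,3)] near_sym by metis
              then show ?thesis using less.IH[of "Suc k''" u w] g f e less.prems by simp
            qed
          next
            case ny: False
            have fH: "f \<in> ?H" using hubI f less.prems(4) ny by blast
            \<comment> \<open>The inner ends \<open>x\<close> and \<open>y\<close> are within
              \<open>d - 2\<close>, so \<open>e\<close> and \<open>f\<close> are within
              \<open>d - 1\<close>, which is at most \<open>p\<close>. This is the step that lowers
              the range of the invariant by one.\<close>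
            have "near (line_graph G) (Suc k') e f"
              by (rule near_line_graph[OF near_sym[OF f(4)] ei(2) fi(2)])
            moreover have "Suc k' \<le> p" using e(1) f(1) less.prems(2) by simp
            ultimately have "near (line_graph G) p e f" by (rule near_mono)
            then have "f \<in> U" using U eU eH fH by blast
            then show ?thesis using all[OF fi(1)] fH by blast
          qed
        qed
      qed
    qed
  qed
qed

section \<open>The invariant under one line graph\<close>

text \<open>For the closure half, a closed set \<open>U\<close> of edges is pulled back to the
  vertices all of whose hub edges lie in \<open>U\<close>. By
  \<open>hubs_line_graph_transfer\<close> this set is closed in \<open>G\<close>, so it contains all
  hubs; and a hub of the line graph is on \<open>q\<close> or has a hub of \<open>G\<close> as an
  end.\<close>

lemma reducible_line_graph:
  assumes G: "mgraph G" "cohesive G (verts G)" "edges G \<noteq> {}"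
    and T: "trail G vs es" and red: "reducible G vs (Suc p)"
  obtains q where "line_trail G q" "reducible (line_graph G) q p"
proof -
  obtain A q where A: "set vs \<subseteq> A" "A \<subseteq> hubs G vs" and q: "line_trail G q"
    and Aq: "set q = \<Union> (inc G ` A)"
    and closed: "\<And>w. w \<in> hubs G vs - A \<Longrightarrow> inc G w \<inter> set q = {}"
    using maximal_absorption[OF G(1) T Union_inc_nonempty[OF G(2) T G(3,1)]] by metis
  have vs: "vs \<noteq> []" "set vs \<subseteq> verts G" using T by (auto simp: trail_def walk_def)
  let ?H = "hubs (line_graph G) q"
  have "?H \<subseteq> U" if qU: "set q \<subseteq> U"
    and U: "\<forall>e \<in> U \<inter> ?H. \<forall>f \<in> ?H. near (line_graph G) p e f \<longrightarrow> f \<in> U" for U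
  proof -
    have hubU: "inc G u \<inter> ?H \<subseteq> U" if "u \<in> hubs G vs" for u
    proof (cases "p = 0")
      case True
      then have "u \<in> A" using maximal_absorption_all[OF _ A(1) Aq closed] red that by auto
      then show ?thesis using Aq qU by blast
    next
      case False
      let ?U = "{v. inc G v \<inter> ?H \<subseteq> U}"
      have "set vs \<subseteq> ?U" using A(1) Aq qU by blast
      moreover have "w \<in> ?U" if h: "v \<in> ?U \<inter> hubs G vs" "w \<in> hubs G vs" "near G (Suc p) v w" for v w
        using hubs_line_graph_transfer[OF G(1) A(1) Aq U False h(3) order_refl _ h(2)] h(1) by simp
      ultimately have "hubs G vs \<subseteq> ?U" by (rule reducible_hubsD[OF red])
      then show ?thesis using that by blast
    qed
    show ?thesis
    proof
      fix e assume e: "e \<in> ?H"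
      show "e \<in> U"
      proof (cases "e \<in> set q")
        case True
        then show ?thesis using qU by blast
      next
        case False
        then have "e \<in> edges G" "card (inc (line_graph G) e) \<ge> 3"
          using e by (auto simp: hubs_def line_graph_simps)
        then obtain u where "u \<in> verts G" "card (inc G u) \<ge> 3" "e \<in> inc G u"
          using hubs_line_graph_ends[OF G(1)] by metis
        then show ?thesis using hubU[of u] e by (auto simp: hubs_def)
      qed
    qed
  qed
  moreover have "card K \<le> Suc p" if "K \<subseteq> edges G - ?H" "cohesive (line_graph G) K" for K
    using reducible_line_graph_cohesive[OF G(1,2) red A Aq closed vs that] .
  ultimately have "reducible (line_graph G) q p"
    unfolding reducible_def line_graph_simps by blast
  with q that show thesis by blast
qed

section \<open>Traceability from the invariant\<close>

lemma traceable_no_edges: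
  assumes "cohesive G (verts G)" "verts G \<noteq> {}" "edges G = {}"
  shows "traceable G"
proof -
  obtain v where v: "v \<in> verts G" using assms(2) by blast
  have "verts G = {v}"
    using cohesiveD[OF assms(1), of "{v}"] assms(3) v by blast
  then have "hamiltonian_path G [v] []"
    by (simp add: hamiltonian_path_def path_def walk_def)
  then show ?thesis by (auto simp: traceable_def)
qed

text \<open>The bound is one rather than an equality because an edgeless connected graph is a single
  vertex: it is traceable, but its line graph is empty.\<close>

lemma traceable_dominating:
  fixes G :: "('v, 'e) egraph"
  assumes "mgraph G" "cohesive G (verts G)" "verts G \<noteq> {}" "trail G vs es"
    and "edges G \<subseteq> \<Union> (inc G ` set vs)"
  shows "\<exists>j \<le> 1. traceable ((line_graph ^^ j) G)"
proof (cases "edges G = {}")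
  case True
  then show ?thesis using traceable_no_edges[OF assms(2,3)] by (intro exI[of _ 0]) simp
next
  case False
  have "edges G = \<Union> (inc G ` set vs)" using assms(5) inc_subset by fast
  then show ?thesis
    using traceable_line_graph_dominating[OF assms(1,4) False] by (intro exI[of _ 1]) simp
qed

text \<open>Each line graph lowers \<open>p\<close> by one. At \<open>p = 0\<close> an edge missing
  the trail would have two ends forming a connected set of non-hubs, where only one vertex is
  allowed; so the trail dominates and one more line graph suffices.\<close>

lemma traceable_reducible:
  fixes G :: "('v, 'e) egraph"
  assumes "mgraph G" "cohesive G (verts G)" "verts G \<noteq> {}" "trail G vs es" "reducible G vs p"
  shows "\<exists>j \<le> Suc p. traceable ((line_graph ^^ j) G)"
  using assms
proof (induction p arbitrary: G vs es)
  case 0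
  \<comment> \<open>At distance zero every set is closed, so the invariant applies to
    \<open>set vs\<close> itself.\<close>
  have hubs: "hubs G vs \<subseteq> set vs"
    by (rule reducible_hubsD[OF 0(5)]) (auto simp: near_0)
  have "e \<in> \<Union> (inc G ` set vs)" if e: "e \<in> edges G" for e
  proof (rule ccontr)
    assume "e \<notin> \<Union> (inc G ` set vs)"
    then have "ends G e \<inter> set vs = {}" using e by (auto simp: inc_def)
    moreover have c: "ends G e \<subseteq> verts G" "card (ends G e) = 2" using e 0(1) by (auto simp: mgraph_def)
    ultimately have "ends G e \<subseteq> verts G - hubs G vs" using hubs by blast
    moreover have "cohesive G (ends G e)"
      unfolding cohesive_def
    proof (intro allI impI)
      fix U assume U: "U \<subseteq> ends G e \<and> U \<noteq> {} \<and> U \<noteq> ends G e"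
      then obtain u v where uv: "u \<in> U" "v \<in> ends G e - U" by blast
      obtain a b where "ends G e = {a, b}" using c(2) by (meson card_2_iff)
      then have "ends G e = {u, v}" using uv U by auto
      then show "\<exists>f \<in> edges G. \<exists>u \<in> U. \<exists>v \<in> ends G e - U. ends G f = {u, v}"
        using uv e by blast
    qed
    ultimately have "card (ends G e) \<le> 1" using reducible_cohesiveD[OF 0(5)] by simp
    then show False using c(2) by simp
  qed
  then show ?case using traceable_dominating[OF 0(1-4)] by auto
next
  case (Suc p)
  show ?case
  proof (cases "edges G = {}")
    case True
    then show ?thesis using traceable_no_edges Suc.prems(2,3) by (intro exI[of _ 0]) simp
  next
    case False
    obtain q where q: "line_trail G q" "reducible (line_graph G) q p"
      using reducible_line_graph[OF Suc.prems(1,2) False Suc.prems(4,5)] .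
    have "\<exists>j \<le> Suc p. traceable ((line_graph ^^ j) (line_graph G))"
    proof (rule Suc.IH[OF _ _ _ trail_links[OF q(1)] q(2)])
      show "mgraph (line_graph G)" using Suc.prems(1) by (rule mgraph_line_graph)
      show "cohesive (line_graph G) (verts (line_graph G))"
        using cohesive_line_graph[OF Suc.prems(1,2)] by (simp add: line_graph_simps)
    qed (simp add: line_graph_simps False)
    then obtain j where "j \<le> Suc p" "traceable ((line_graph ^^ Suc j) G)"
      by (auto simp: funpow_swap1)
    then show ?thesis by (intro exI[of _ "Suc j"]) simp
  qed
qed

section \<open>The invariant at the start and the bound\<close>

text \<open>The balls around the set of hubs that are not reached grow by at least one vertex per step and
  avoid the trail, so they would soon exhaust the vertices off the trail.\<close>

lemma reducible_trail:
  assumes "mgraph G" "cohesive G (verts G)" "trail G vs es" "card (verts G - set vs) = Suc (Suc r)"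
  shows "reducible G vs (Suc r)"
proof -
  have fin: "finite (verts G)" using assms(1) by (simp add: mgraph_def)
  have vs: "vs \<noteq> []" "set vs \<subseteq> verts G" using assms(3) by (auto simp: trail_def walk_def)
  have "hubs G vs \<subseteq> U" if U: "set vs \<subseteq> U"
    "\<forall>u \<in> U \<inter> hubs G vs. \<forall>w \<in> hubs G vs. near G (Suc r) u w \<longrightarrow> w \<in> U" for U
  proof (rule ccontr)
    assume not: "\<not> hubs G vs \<subseteq> U"
    define W where "W = hubs G vs - U"
    define N where "N i = {x \<in> verts G. \<exists>w \<in> W. near G i x w}" for i
    have "W \<noteq> {}" "W \<subseteq> verts G" using not vs by (auto simp: W_def hubs_def)
    then have N0: "N 0 = W" by (auto simp: N_def near_0)
    have mono: "N i \<subseteq> N j" if "i \<le> j" for i j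
      using that near_mono by (fastforce simp: N_def)
    have avoid: "N (Suc r) \<subseteq> verts G - set vs"
    proof
      fix x assume x: "x \<in> N (Suc r)"
      then obtain w where w: "x \<in> verts G" "w \<in> W" "near G (Suc r) x w" by (auto simp: N_def)
      have "x \<notin> set vs"
      proof
        assume "x \<in> set vs"
        then have "x \<in> U \<inter> hubs G vs" using U(1) by (auto simp: hubs_def)
        then show False using U(2) w by (auto simp: W_def)
      qed
      with w show "x \<in> verts G - set vs" by blast
    qed
    \<comment> \<open>The ball is not everything since it avoids the nonempty trail, and
      \<open>G\<close> is connected, so some edge leaves it.\<close>
    have grow: "card (N i) < card (N (Suc i))" if "i \<le> Suc r" for i
    proof -
      have "hd vs \<in> set vs" "hd vs \<in> verts G" using vs by auto
      then have "N i \<noteq> verts G" using avoid mono[OF that] by blast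
      moreover have "N i \<subseteq> verts G" by (auto simp: N_def)
      moreover have "N i \<noteq> {}" using mono[of 0 i] N0 \<open>W \<noteq> {}\<close> by auto
      ultimately obtain e u v where e: "e \<in> edges G" "u \<in> N i" "v \<in> verts G - N i" "ends G e = {u, v}"
        using cohesiveD[OF assms(2)] by metis
      then obtain w where w: "w \<in> W" "near G i u w" by (auto simp: N_def)
      then have "near G (Suc i) v w" using near_step[of e G v u i w] e by (simp add: insert_commute)
      then have "v \<in> N (Suc i)" using w e(3) by (auto simp: N_def)
      then have "N i \<subset> N (Suc i)" using mono[of i "Suc i"] e(3) by auto
      then show ?thesis using fin by (intro psubset_card_mono) (auto simp: N_def)
    qed
    have "card (N 1) + i \<le> card (N (Suc i))" if "i \<le> r" for i
      using that
    proof (induction i)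
      case (Suc i)
      then show ?case using grow[of "Suc i"] by simp
    qed simp
    \<comment> \<open>Only \<open>r + 2\<close> vertices lie off the trail, so the ball of radius
      one has at most two: one unreached hub \<open>w\<close> and one neighbour
      \<open>x\<close>.\<close>
    then have "card (N 1) + r \<le> card (N (Suc r))" by blast
    also have "\<dots> \<le> card (verts G - set vs)" using avoid fin by (intro card_mono) auto
    finally have N1: "card (N 1) \<le> 2" using assms(4) by simp
    have finN: "finite (N i)" for i using fin by (simp add: N_def)
    have "card W \<noteq> 0" using N0 finN[of 0] \<open>W \<noteq> {}\<close> by simp
    then have "card W = 1" "card (N 1) = 2" using grow[of 0] N0 N1 by auto
    then obtain w where w: "W = {w}" by (meson card_1_singletonE)
    have "w \<in> N 1" using mono[of 0 1] N0 w by auto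
    then obtain x where x: "N 1 = {w, x}" "x \<noteq> w"
      using \<open>card (N 1) = 2\<close> by (auto simp: card_2_iff doubleton_eq_iff)
    have nb: "ends G e = {w, x}" if e: "e \<in> inc G w" for e
    proof -
      obtain y where y: "ends G e = {w, y}" "y \<noteq> w" "y \<in> verts G"
        using ends_obtain[OF assms(1) e] .
      have "near G (Suc 0) y w" using near_edge[of e G y w 0] e y(1) by (simp add: inc_def insert_commute)
      then have "y \<in> N 1" using y(3) w by (auto simp: N_def)
      then show ?thesis using x y by auto
    qed
    have w3: "card (inc G w) \<ge> 3" using w U(1) by (auto simp: W_def hubs_def)
    then have "inc G w \<noteq> {}" by auto
    then obtain e where e: "e \<in> inc G w" by blast
    \<comment> \<open>All edges at \<open>w\<close> are parallel and end in \<open>x\<close>, so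
      \<open>x\<close> is a hub too. It is not in \<open>W\<close>, hence in \<open>U\<close>, and
      being adjacent to \<open>w\<close> it would put \<open>w\<close> into
      \<open>U\<close>.\<close>
    have "inc G w \<subseteq> inc G x" using nb by (auto simp: inc_def)
    then have "card (inc G x) \<ge> 3" using w3 card_mono[OF finite_inc[OF assms(1)]] order_trans by blast
    moreover have "x \<in> verts G" using x by (auto simp: N_def)
    ultimately have "x \<in> hubs G vs" by (simp add: hubs_def)
    moreover from this have "x \<in> U" using w x(2) by (auto simp: W_def)
    moreover have "near G (Suc r) x w"
      using near_edge[of e G x w r] nb[OF e] e by (simp add: inc_def insert_commute)
    ultimately show False using U(2) w by (auto simp: W_def)
  qed
  moreover have "card K \<le> Suc (Suc r)" if "K \<subseteq> verts G - hubs G vs" for K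
  proof -
    have "K \<subseteq> verts G - set vs" using that by (auto simp: hubs_def)
    then show ?thesis using card_mono[of "verts G - set vs" K] fin assms(4) by simp
  qed
  ultimately show ?thesis unfolding reducible_def by blast
qed

text \<open>With at most one vertex off the trail, no edge can miss the trail. With
  \<open>k \<ge> 2\<close> vertices off it, the invariant starts at \<open>p = k - 1\<close> and
  yields at most \<open>k\<close> line graphs.\<close>

lemma traceable_within:
  fixes G :: "('v, 'e) egraph"
  assumes "mgraph G" "cohesive G (verts G)" "trail G vs es"
  shows "\<exists>j \<le> max 1 (card (verts G - set vs)). traceable ((line_graph ^^ j) G)"
proof -
  have vs: "vs \<noteq> []" "set vs \<subseteq> verts G" using assms(3) by (auto simp: trail_def walk_def)
  then have ne: "verts G \<noteq> {}" by auto
  show ?thesis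
  proof (cases "card (verts G - set vs) \<le> 1")
    case True
    have "e \<in> \<Union> (inc G ` set vs)" if e: "e \<in> edges G" for e
    proof (rule ccontr)
      assume "e \<notin> \<Union> (inc G ` set vs)"
      then have "ends G e \<subseteq> verts G - set vs"
        using e assms(1) by (auto simp: inc_def mgraph_def)
      then have "card (ends G e) \<le> 1"
        using card_mono[of "verts G - set vs" "ends G e"] assms(1) True by (simp add: mgraph_def)
      then show False using e assms(1) by (simp add: mgraph_def)
    qed
    then have "edges G \<subseteq> \<Union> (inc G ` set vs)" by blast
    then show ?thesis using traceable_dominating[OF assms(1,2) ne assms(3)] True by simp
  next
    case False
    then obtain r where r: "card (verts G - set vs) = Suc (Suc r)"
      by (metis One_nat_def le_0_eq not0_implies_Suc not_less_eq_eq)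
    have "reducible G vs (Suc r)" using reducible_trail[OF assms r] .
    then show ?thesis using traceable_reducible[OF assms(1,2) ne assms(3)] r by simp
  qed
qed

section \<open>Transfer to the embedded graph\<close>

lemma cohesive_embed:
  assumes "cohesive G (verts G)"
  shows "cohesive (embed G) (verts (embed G))"
  unfolding cohesive_def
proof (intro allI impI)
  fix U assume U: "U \<subseteq> verts (embed G) \<and> U \<noteq> {} \<and> U \<noteq> verts (embed G)"
  have V: "verts (embed G) = Vert ` verts G" by (simp add: embed_def)
  obtain S where S: "S \<subseteq> verts G" "U = Vert ` S" using U V subset_imageE by metis
  then have "S \<noteq> {}" "S \<noteq> verts G" using U V by auto
  then obtain e u v where e: "e \<in> edges G" "u \<in> S" "v \<in> verts G - S" "ends G e = {u, v}"
    using cohesiveD[OF assms S(1)] by metis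
  then have "Edge e \<in> edges (embed G)" "ends (embed G) (Edge e) = {Vert u, Vert v}"
    "Vert u \<in> U" "Vert v \<in> verts (embed G) - U"
    using S by (auto simp: embed_def)
  then show "\<exists>e \<in> edges (embed G). \<exists>u \<in> U. \<exists>v \<in> verts (embed G) - U. ends (embed G) e = {u, v}"
    by blast
qed

lemma mt_star_trail:
  assumes "mgraph G" "verts G \<noteq> {}"
  obtains vs es where "trail G vs es" "card (set vs) = mt_star G"
proof -
  let ?C = "{card (set vs) | vs es. trail G vs es}"
  obtain v where "v \<in> verts G" using assms(2) by blast
  then have "trail G [v] []" by (simp add: trail_def walk_def)
  then have "?C \<noteq> {}" by blast
  moreover have "finite (verts G)" using assms(1) by (simp add: mgraph_def)
  then have "?C \<subseteq> {..card (verts G)}" by (auto simp: trail_def walk_def intro: card_mono)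
  then have "finite ?C" by (rule finite_subset) simp
  ultimately have "Max ?C \<in> ?C" by (intro Max_in)
  then show thesis using that unfolding mt_star_def by fastforce
qed

theorem corollary16:
  fixes G :: "('v, 'e) mgraph" and n :: nat
  assumes "mgraph G"
    and "connected_mgraph G"
    and "card (verts G) = n"
  shows "hamiltonian_path_index G \<le> enat (max 1 (n - mt_star G))"
proof -
  have "verts G \<noteq> {}" using assms(2) by (simp add: connected_mgraph_def)
  then obtain vs es where T: "trail G vs es" "card (set vs) = mt_star G"
    using mt_star_trail[OF assms(1)] by metis
  let ?vs = "map Vert vs :: ('v, 'e) elem list" and ?es = "map Edge es :: ('v, 'e) elem list"
  have trail: "trail (embed G) ?vs ?es"
    using T(1) by (simp add: trail_def walk_embed_iff distinct_map inj_on_def)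
  \<comment> \<open>The embedding preserves the number of vertices off the trail, which is
    \<open>n - mt_star G\<close> for the trail chosen.\<close>
  have "verts (embed G) - set ?vs = Vert ` (verts G - set vs)"
    by (auto simp: embed_def)
  then have "card (verts (embed G) - set ?vs) = card (verts G - set vs)"
    by (simp add: card_image inj_on_def)
  also have "\<dots> = n - mt_star G"
    using T assms(3) by (subst card_Diff_subset) (auto simp: trail_def walk_def)
  finally obtain j where j: "j \<le> max 1 (n - mt_star G)" "traceable ((line_graph ^^ j) (embed G))"
    using traceable_within[OF mgraph_embed[OF assms(1)] cohesive_embed trail]
      cohesive_verts[OF assms(2)] by metis
  have "hamiltonian_path_index G \<le> enat j"
    unfolding hamiltonian_path_index_def iter_line_graph_def using j(2) by (intro Inf_lower) blast
  also have "\<dots> \<le> enat (max 1 (n - mt_star G))" using j(1) by simp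
  finally show ?thesis .
qed

end
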